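(* Let $S$ be a finite semigroup and let $S_1,\ldots,S_n$ denote the (vertex sets of the) connected components of the upper non-nilpotent graph $\mathcal{N}_S$. If for all $1\le i\le n$ the connected component $S_i$ is complete and $|S_i|>1$, then $S=S_{\sigma(1)}\,\angle\,S_{\sigma(2)}\,\angle\cdots\angle\,S_{\sigma(n)}$ for some permutation $\sigma\in \mathrm{Sym}_n$.
   Context: For a semigroup $S$, $S^1$ denotes $S$ if $S$ has an identity, and otherwise $S$ with an identity $1$ adjoined. For $x,y\in S$ and $z_1,z_2,\ldots\in S^1$ define recursively $\lambda_0=x$, $\rho_0=y$, $\lambda_{n+1}=\lambda_n z_{n+1}\rho_n$, $\rho_{n+1}=\rho_n z_{n+1}\lambda_n$; write $\lambda_n(x,y,z_1,\ldots,z_n)$, $\rho_n(x,y,z_1,\ldots,z_n)$. A semigroup $S$ is nilpotent (in the sense of Malcev) if there is a positive integer $n$ with $\lambda_n(a,b,c_1,\ldots,c_n)=\rho_n(a,b,c_1,\ldots,c_n)$ for all $a,b\in S$, $c_1,\ldots,c_n\in S^1$. The upper non-nilpotent graph $\mathcal{N}_S$ has vertex set $S$, with distinct $x,y$ adjacent iff the subsemigroup $\langle x,y\rangle$ is not nilpotent. A connected component is complete if every two distinct vertices in it are adjacent. For semigroups $T,U$, $T\angle U$ denotes the semigroup that is the disjoint union $T\cup U$, containing $T$ and $U$ as subsemigroups, with $U$ an ideal and $ut=u=tu$ for all $u\in U$, $t\in T$. For semigroups $S_1,\ldots,S_n$, $S_1\angle S_2\angle\cdots\angle S_n$ denotes the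 semigroup that is the disjoint union of the subsemigroups $S_i$ and such that $S_i\cup S_j=S_i\angle S_j$ for all $1\le i<j\le n$ (for $n=1$ it is just $S_1$). *)

theory Defs
  imports
    "HOL.Hull"
    "HOL-Library.Disjoint_Sets"
    "HOL-Combinatorics.Permutations"
    "Graph_Theory.Graph_Theory"
begin

text \<open>
  A semigroup is a nonempty multiplicatively closed subset of a type of class
  \<^class>\<open>semigroup_mult\<close>. The ambient type may have elements outside the
  semigroup, and all notions below are relative to the given subset; taking the
  subset to be \<open>UNIV\<close> gives the semigroup carried by the whole type.
\<close>

definition subsemigroup :: "'a::semigroup_mult set \<Rightarrow> bool" where
  "subsemigroup T \<longleftrightarrow> T \<noteq> {} \<and> (\<forall>x\<in>T. \<forall>y\<in>T. x * y \<in> T)"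

definition semigroup_ideal :: "'a::semigroup_mult set \<Rightarrow> 'a set \<Rightarrow> bool" where
  "semigroup_ideal U P \<longleftrightarrow>
     U \<noteq> {} \<and> U \<subseteq> P \<and> (\<forall>u\<in>U. \<forall>p\<in>P. u * p \<in> U \<and> p * u \<in> U)"

definition has_identity :: "'a::semigroup_mult set \<Rightarrow> bool" where
  "has_identity T \<longleftrightarrow> (\<exists>e\<in>T. \<forall>x\<in>T. e * x = x \<and> x * e = x)"

text \<open>
  \<open>T\<^sup>1\<close> is represented in the option type: \<open>Some t\<close> stands for
  \<open>t \<in> T\<close> and \<open>None\<close> for the adjoined identity, which is present only if
  \<open>T\<close> has no identity of its own. \<open>rmult1 a z\<close> is the product \<open>a z\<close> of
  \<open>a \<in> T\<close> and \<open>z \<in> T\<^sup>1\<close>, which lies in \<open>T\<close> again.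
\<close>

definition adjoin_one :: "'a::semigroup_mult set \<Rightarrow> 'a option set" where
  "adjoin_one T = (if has_identity T then Some ` T else insert None (Some ` T))"

fun rmult1 :: "'a::semigroup_mult \<Rightarrow> 'a option \<Rightarrow> 'a" where
  "rmult1 a None = a"
| "rmult1 a (Some z) = a * z"

text \<open>Only the values \<open>c 1, \<dots>, c n\<close> of the sequence \<open>c\<close> enter at stage \<open>n\<close>.\<close>

fun malcev_lambda :: "nat \<Rightarrow> 'a::semigroup_mult \<Rightarrow> 'a \<Rightarrow> (nat \<Rightarrow> 'a option) \<Rightarrow> 'a"
  and malcev_rho :: "nat \<Rightarrow> 'a::semigroup_mult \<Rightarrow> 'a \<Rightarrow> (nat \<Rightarrow> 'a option) \<Rightarrow> 'a"
where
  "malcev_lambda 0 x y c = x"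
| "malcev_lambda (Suc n) x y c =
     rmult1 (malcev_lambda n x y c) (c (Suc n)) * malcev_rho n x y c"
| "malcev_rho 0 x y c = y"
| "malcev_rho (Suc n) x y c =
     rmult1 (malcev_rho n x y c) (c (Suc n)) * malcev_lambda n x y c"

definition malcev_nilpotent :: "'a::semigroup_mult set \<Rightarrow> bool" where
  "malcev_nilpotent T \<longleftrightarrow>
     (\<exists>n>0. \<forall>a\<in>T. \<forall>b\<in>T. \<forall>c. (\<forall>i\<in>{1..n}. c i \<in> adjoin_one T) \<longrightarrow>
        malcev_lambda n a b c = malcev_rho n a b c)"

definition nonnilpotent_graph :: "'a::semigroup_mult set \<Rightarrow> 'a pair_pre_digraph" where
  "nonnilpotent_graph S = \<lparr> pverts = S,
     parcs = {(x, y). x \<in> S \<and> y \<in> S \<and> x \<noteq> y \<and>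
                      \<not> malcev_nilpotent (subsemigroup hull {x, y})} \<rparr>"

text \<open>In Graph_Theory, an undirected simple graph is a symmetric loopless digraph.\<close>

lemma pair_graph_nonnilpotent_graph:
  assumes "finite S"
  shows "pair_graph (nonnilpotent_graph S)"
proof -
  have "parcs (nonnilpotent_graph S) \<subseteq> S \<times> S"
    by (auto simp: nonnilpotent_graph_def)
  then have "finite (parcs (nonnilpotent_graph S))"
    using assms by (meson finite_SigmaI finite_subset)
  moreover have "sym (parcs (nonnilpotent_graph S))"
    by (auto simp: nonnilpotent_graph_def sym_def insert_commute)
  ultimately show ?thesis
    using assms
    by unfold_locales (auto simp: nonnilpotent_graph_def symmetric_def)
qed

text \<open>
  As the graph is symmetric, its connected components are its strongly connected
  components; \<open>sccs_verts\<close> collects their vertex sets.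
\<close>

definition nonnilpotent_components :: "'a::semigroup_mult set \<Rightarrow> 'a set set" where
  "nonnilpotent_components S = pre_digraph.sccs_verts (with_proj (nonnilpotent_graph S))"

definition complete_component :: "'a::semigroup_mult set \<Rightarrow> 'a set \<Rightarrow> bool" where
  "complete_component S C \<longleftrightarrow>
     (\<forall>x\<in>C. \<forall>y\<in>C. x \<noteq> y \<longrightarrow> x \<rightarrow>\<^bsub>with_proj (nonnilpotent_graph S)\<^esub> y)"

text \<open>
  \<open>is_angle P T U\<close> states \<open>P = T \<angle> U\<close>, and \<open>is_angle_seq P n T\<close> states
  \<open>P = T 1 \<angle> T 2 \<angle> \<cdots> \<angle> T n\<close>, as decompositions of a given semigroup \<open>P\<close>;
  the multiplications are the restrictions of that of the ambient type.
\<close>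

definition is_angle :: "'a::semigroup_mult set \<Rightarrow> 'a set \<Rightarrow> 'a set \<Rightarrow> bool" where
  "is_angle P T U \<longleftrightarrow>
     P = T \<union> U \<and> T \<inter> U = {} \<and> subsemigroup T \<and> subsemigroup U \<and>
     semigroup_ideal U P \<and> (\<forall>u\<in>U. \<forall>t\<in>T. u * t = u \<and> t * u = u)"

definition is_angle_seq :: "'a::semigroup_mult set \<Rightarrow> nat \<Rightarrow> (nat \<Rightarrow> 'a set) \<Rightarrow> bool" where
  "is_angle_seq P n T \<longleftrightarrow>
     P = (\<Union>i\<in>{1..n}. T i) \<and> disjoint_family_on T {1..n} \<and>
     (\<forall>i\<in>{1..n}. subsemigroup (T i)) \<and>
     (\<forall>i\<in>{1..n}. \<forall>j\<in>{1..n}. i < j \<longrightarrow> is_angle (T i \<union> T j) (T i) (T j))"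

end

theory Submission
  imports Defs
begin

text \<open>
  Commuting elements generate a commutative, hence nilpotent, subsemigroup, so they are never
  adjacent. A neighbour of \<open>x * x\<close> is also a neighbour of \<open>x\<close>, so \<open>x\<close> and \<open>x * x\<close> lie in one
  component, and completeness of the components forces \<open>x = x * x\<close>: the semigroup is a band. In
  a band, \<open>x * y \<noteq> y * x\<close> makes \<open>\<langle>x, y\<rangle>\<close> non-nilpotent, because the Malcev sequence of \<open>x * y\<close>
  and \<open>y * x\<close> with trivial parameters has period two. So adjacency is non-commutation, and the
  components partition the band in such a way that two distinct elements commute iff they lie in
  different components.

  An element not commuting with \<open>x * y\<close> fails to commute with \<open>x\<close> or with \<open>y\<close>, so \<open>x * y\<close> lies in the
  component of \<open>x\<close> or of \<open>y\<close>. If these components differ, then \<open>x * y\<close> commutes with both factors,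
  so it is one of them. Hence elements of different components are comparable in
  the natural order of the band, and the outcome depends only on the two components.
\<close>

section \<open>Nilpotency with an identity always adjoined\<close>

lemma subsemigroup_hull:
  assumes "A \<noteq> {}"
  shows "subsemigroup (subsemigroup hull A)"
  unfolding subsemigroup_def[of "subsemigroup hull A"]
proof (intro conjI ballI)
  show "subsemigroup hull A \<noteq> {}"
    using assms hull_subset[of A subsemigroup] by blast
next
  fix x y assume "x \<in> subsemigroup hull A" "y \<in> subsemigroup hull A"
  then show "x * y \<in> subsemigroup hull A"
    by (auto simp: hull_def subsemigroup_def)
qed

lemma rmult1_closed:
  assumes "subsemigroup S" "x \<in> S" "y \<in> S" "z \<in> insert None (Some ` S)"
  shows "rmult1 x z * y \<in> S"
  using assms by (auto simp: subsemigroup_def)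

lemma malcev_lambda_rho_closed:
  assumes S: "subsemigroup S" and "a \<in> S" "b \<in> S"
    and "\<And>i. i \<in> {1..n} \<Longrightarrow> c i \<in> insert None (Some ` S)"
  shows "malcev_lambda n a b c \<in> S \<and> malcev_rho n a b c \<in> S"
  using assms(2-)
proof (induction n)
  case (Suc n)
  have "c (Suc n) \<in> insert None (Some ` S)"
    using Suc.prems(3) by simp
  moreover have "malcev_lambda n a b c \<in> S \<and> malcev_rho n a b c \<in> S"
    using Suc by simp
  ultimately show ?case
    using rmult1_closed[OF S] by simp
qed simp

text \<open>Parameters only ever act by right multiplication on intermediate values, and these stay
  in \<open>S\<close>; so agreement of that action on \<open>S\<close> suffices. This lets an
  adjoined identity be exchanged for a genuine one.\<close>

lemma malcev_lambda_rho_cong: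
  assumes S: "subsemigroup S" and "a \<in> S" "b \<in> S"
    and "\<And>i. i \<in> {1..n} \<Longrightarrow> c i \<in> insert None (Some ` S)"
    and "\<And>i x. i \<in> {1..n} \<Longrightarrow> x \<in> S \<Longrightarrow> rmult1 x (d i) = rmult1 x (c i)"
  shows "malcev_lambda n a b d = malcev_lambda n a b c \<and> malcev_rho n a b d = malcev_rho n a b c"
  using assms(2-)
proof (induction n)
  case (Suc n)
  have "malcev_lambda n a b c \<in> S \<and> malcev_rho n a b c \<in> S"
    using malcev_lambda_rho_closed[OF S] Suc.prems by simp
  moreover have "malcev_lambda n a b d = malcev_lambda n a b c \<and>
      malcev_rho n a b d = malcev_rho n a b c"
    using Suc by simp
  moreover have "rmult1 x (d (Suc n)) = rmult1 x (c (Suc n))" if "x \<in> S" for x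
    using Suc.prems(4)[of "Suc n" x] that by simp
  ultimately show ?case by simp
qed simp

text \<open>If \<open>S\<close> has an identity \<open>e\<close>, then \<open>Some e\<close> acts on
  \<open>S\<close> exactly as \<open>None\<close> does; in all other cases \<open>z\<close> already
  lies in \<open>adjoin_one S\<close>.\<close>

lemma adjoin_one_representative:
  assumes "z \<in> insert None (Some ` S)"
  obtains z' where "z' \<in> adjoin_one S" "\<And>x. x \<in> S \<Longrightarrow> rmult1 x z' = rmult1 x z"
proof (cases "z = None \<and> has_identity S")
  case True
  then obtain e where "e \<in> S" "\<And>x. x \<in> S \<Longrightarrow> x * e = x"
    by (auto simp: has_identity_def)
  then show thesis
    using that[of "Some e"] True by (simp add: adjoin_one_def)
next
  case False
  then show thesis
    using that[of z] assms by (auto simp: adjoin_one_def)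
qed

text \<open>\<open>adjoin_one\<close> is not monotone: \<open>None\<close> may belong to it for a
  subsemigroup and not for the whole. Always admitting \<open>None\<close> gives a monotone
  parameter set, so nilpotency passes to subsemigroups with the same \<open>n\<close>, and trivial
  parameters are always available.\<close>

lemma malcev_nilpotent_iff:
  assumes S: "subsemigroup S"
  shows "malcev_nilpotent S \<longleftrightarrow>
    (\<exists>n>0. \<forall>a\<in>S. \<forall>b\<in>S. \<forall>c. (\<forall>i\<in>{1..n}. c i \<in> insert None (Some ` S)) \<longrightarrow>
       malcev_lambda n a b c = malcev_rho n a b c)" (is "_ \<longleftrightarrow> ?R")
proof
  assume "malcev_nilpotent S"
  then obtain n where "n > 0"
    and n: "\<And>a b c. \<lbrakk>a \<in> S; b \<in> S; \<forall>i\<in>{1..n}. c i \<in> adjoin_one S\<rbrakk> \<Longrightarrow>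
      malcev_lambda n a b c = malcev_rho n a b c"
    unfolding malcev_nilpotent_def by blast
  have "malcev_lambda n a b c = malcev_rho n a b c"
    if ab: "a \<in> S" "b \<in> S" and c: "\<forall>i\<in>{1..n}. c i \<in> insert None (Some ` S)" for a b c
  proof -
    have "\<forall>i\<in>{1..n}. \<exists>z. z \<in> adjoin_one S \<and> (\<forall>x\<in>S. rmult1 x z = rmult1 x (c i))"
      using c adjoin_one_representative by metis
    then obtain d where "\<forall>i\<in>{1..n}. d i \<in> adjoin_one S \<and> (\<forall>x\<in>S. rmult1 x (d i) = rmult1 x (c i))"
      by metis
    then have "malcev_lambda n a b d = malcev_rho n a b d"
      and "malcev_lambda n a b d = malcev_lambda n a b c \<and> malcev_rho n a b d = malcev_rho n a b c"
      using n[OF ab] malcev_lambda_rho_cong[OF S ab] c by blast+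
    then show ?thesis by metis
  qed
  with \<open>n > 0\<close> show ?R by blast
next
  assume ?R
  moreover have "adjoin_one S \<subseteq> insert None (Some ` S)"
    by (auto simp: adjoin_one_def)
  ultimately show "malcev_nilpotent S"
    unfolding malcev_nilpotent_def by (meson subsetD)
qed

lemma malcev_nilpotent_subset:
  assumes "subsemigroup T" "subsemigroup S" "T \<subseteq> S" "malcev_nilpotent S"
  shows "malcev_nilpotent T"
proof -
  have "insert None (Some ` T) \<subseteq> insert None (Some ` S)"
    using assms(3) by blast
  then show ?thesis
    using assms unfolding malcev_nilpotent_iff[OF assms(1)] malcev_nilpotent_iff[OF assms(2)]
    by (meson subsetD)
qed

section \<open>Nilpotency against commutation\<close>

text \<open>A double centralizer argument: the generated subsemigroup first lies in the centralizer
  of the generators, hence the generators lie in its centralizer, hence so does all of it.\<close>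

lemma hull_pair_commute:
  fixes x y :: "'a::semigroup_mult"
  assumes xy: "x * y = y * x"
    and a: "a \<in> subsemigroup hull {x, y}" and b: "b \<in> subsemigroup hull {x, y}"
  shows "a * b = b * a"
proof -
  \<comment> \<open>The assumption on \<open>x\<close> supplies the element that makes the
    centralizer nonempty.\<close>
  have centralizer: "subsemigroup {z. \<forall>w\<in>A. z * w = w * z}"
    if "\<forall>w\<in>A. x * w = w * x" for A :: "'a set"
    unfolding subsemigroup_def
  proof (intro conjI ballI)
    show "{z. \<forall>w\<in>A. z * w = w * z} \<noteq> {}" using that by blast
  next
    fix u v assume uv: "u \<in> {z. \<forall>w\<in>A. z * w = w * z}" "v \<in> {z. \<forall>w\<in>A. z * w = w * z}"
    have "u * v * w = w * (u * v)" if "w \<in> A" for w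
    proof -
      have uw: "u * w = w * u" and vw: "v * w = w * v" using uv that by auto
      have "u * v * w = u * w * v" by (simp only: mult.assoc vw)
      also have "\<dots> = w * (u * v)" unfolding uw by (rule mult.assoc)
      finally show ?thesis .
    qed
    then show "u * v \<in> {z. \<forall>w\<in>A. z * w = w * z}" by blast
  qed
  have sub: "subsemigroup hull {x, y} \<subseteq> {z. \<forall>w\<in>{x, y}. z * w = w * z}"
    using xy by (intro hull_minimal centralizer) auto
  have "subsemigroup hull {x, y} \<subseteq> {z. \<forall>w\<in>subsemigroup hull {x, y}. z * w = w * z}"
  proof (intro hull_minimal centralizer)
    show "{x, y} \<subseteq> {z. \<forall>w\<in>subsemigroup hull {x, y}. z * w = w * z}" using sub by auto
    show "\<forall>w\<in>subsemigroup hull {x, y}. x * w = w * x" using sub by auto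
  qed
  then show ?thesis using a b by blast
qed

text \<open>By commutativity a z b = b z a, so the two sequences agree from stage 1 on.\<close>

lemma malcev_nilpotent_hull_commuting:
  fixes x y :: "'a::semigroup_mult"
  assumes "x * y = y * x"
  shows "malcev_nilpotent (subsemigroup hull {x, y})"
proof -
  let ?H = "subsemigroup hull {x, y}"
  have S: "subsemigroup ?H"
    by (simp add: subsemigroup_hull)
  have comm: "a * b = b * a" if "a \<in> ?H" "b \<in> ?H" for a b
    using hull_pair_commute[OF assms] that .
  have "rmult1 a z * b = rmult1 b z * a"
    if "a \<in> ?H" "b \<in> ?H" "z \<in> insert None (Some ` ?H)" for a b z
  proof (cases z)
    case None
    then show ?thesis using comm that by simp
  next
    case (Some t)
    then have t: "t \<in> ?H" using that by auto
    have "a * t * b = t * (a * b)" using comm[OF that(1) t] by (simp add: mult.assoc)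
    also have "\<dots> = b * t * a"
      using comm[OF that(1,2)] comm[OF that(2) t] by (simp add: mult.assoc[symmetric])
    finally show ?thesis using Some by simp
  qed
  then have "\<forall>a\<in>?H. \<forall>b\<in>?H. \<forall>c. (\<forall>i\<in>{1..1}. c i \<in> insert None (Some ` ?H)) \<longrightarrow>
      malcev_lambda 1 a b c = malcev_rho 1 a b c"
    by simp
  then show ?thesis
    unfolding malcev_nilpotent_iff[OF S] by (meson zero_less_one)
qed

lemma not_malcev_nilpotent_band:
  assumes S: "subsemigroup S" and idem: "\<And>z. z \<in> S \<Longrightarrow> z * z = z"
    and xy: "x \<in> S" "y \<in> S" "x * y \<noteq> y * x"
  shows "\<not> malcev_nilpotent S"
proof
  assume "malcev_nilpotent S"
  let ?c = "\<lambda>_. None"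
  let ?l = "\<lambda>n. malcev_lambda n (x * y) (y * x) ?c"
  let ?r = "\<lambda>n. malcev_rho n (x * y) (y * x) ?c"
  have cl: "x * y \<in> S" "y * x \<in> S" using S xy by (auto simp: subsemigroup_def)
  from \<open>malcev_nilpotent S\<close> obtain n where
    "\<forall>a\<in>S. \<forall>b\<in>S. \<forall>c. (\<forall>i\<in>{1..n}. c i \<in> insert None (Some ` S)) \<longrightarrow>
       malcev_lambda n a b c = malcev_rho n a b c"
    unfolding malcev_nilpotent_iff[OF S] by blast
  then have n: "?l n = ?r n" using cl by simp
  \<comment> \<open>Idempotency restated for right-associated words, the form the simplifier reaches
    below.\<close>
  have idem': "z * (z * w) = z * w" if "z \<in> S" for z w
    using idem[OF that] by (simp add: mult.assoc[symmetric])
  have xyxy: "x * (y * (x * y)) = x * y" "y * (x * (y * x)) = y * x"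
    using idem[OF cl(1)] idem[OF cl(2)] by (simp_all add: mult.assoc)
  \<comment> \<open>One step leads to xyx and yxy, the next to xyxyxy = xy and yxyxyx = yx.\<close>
  have per: "?l (2 * k) = x * y \<and> ?r (2 * k) = y * x" for k
    by (induction k) (simp_all add: mult.assoc idem' xy xyxy)
  have "?l (2 * n) = ?r (2 * n)"
  proof -
    \<comment> \<open>Once the sequences meet they stay equal, which carries equality from
      \<open>n\<close> to the even index \<open>2 * n\<close>.\<close>
    have "?l (n + k) = ?r (n + k)" for k
      by (induction k) (simp_all add: n)
    then show ?thesis by (simp add: mult_2)
  qed
  with per[of n] xy show False by metis
qed

section \<open>Components of the graph\<close>

lemma adjacent_iff:
  "x \<rightarrow>\<^bsub>with_proj (nonnilpotent_graph S)\<^esub> y \<longleftrightarrow>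
     x \<in> S \<and> y \<in> S \<and> x \<noteq> y \<and> \<not> malcev_nilpotent (subsemigroup hull {x, y})"
  by (simp add: nonnilpotent_graph_def)

lemma Union_nonnilpotent_components:
  assumes "finite S"
  shows "\<Union> (nonnilpotent_components S) = S"
proof -
  interpret pair_graph "nonnilpotent_graph S"
    using assms by (rule pair_graph_nonnilpotent_graph)
  have verts: "pverts (nonnilpotent_graph S) = S"
    by (simp add: nonnilpotent_graph_def)
  show ?thesis
  proof (intro equalityI subsetI)
    fix x assume "x \<in> \<Union> (nonnilpotent_components S)"
    then obtain A where A: "A \<in> nonnilpotent_components S" "x \<in> A" by blast
    have "A \<subseteq> S"
      using sccs_verts_subsets[OF A(1)[unfolded nonnilpotent_components_def]] by (simp add: verts)
    with A(2) show "x \<in> S" by blast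
  next
    fix x assume x: "x \<in> S"
    have "x \<in> scc_of x" "scc_of x \<in> nonnilpotent_components S"
      unfolding nonnilpotent_components_def
      using x by (simp_all add: in_scc_of_self scc_of_in_sccs_verts verts)
    then show "x \<in> \<Union> (nonnilpotent_components S)" by blast
  qed
qed

lemma nonnilpotent_components_disjoint:
  assumes "finite S" "A \<in> nonnilpotent_components S" "B \<in> nonnilpotent_components S" "A \<noteq> B"
  shows "A \<inter> B = {}"
proof -
  interpret pair_graph "nonnilpotent_graph S"
    using assms by (intro pair_graph_nonnilpotent_graph)
  show ?thesis
    using assms sccs_verts_disjoint unfolding nonnilpotent_components_def by blast
qed

text \<open>By symmetry an arc gives reachability in both directions, which puts its ends into one
  strong component.\<close>

lemma adjacent_same_component:
  assumes "finite S" "A \<in> nonnilpotent_components S" "x \<in> A"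
    and adj: "x \<rightarrow>\<^bsub>with_proj (nonnilpotent_graph S)\<^esub> y"
  shows "y \<in> A"
proof -
  interpret pair_graph "nonnilpotent_graph S"
    using assms by (intro pair_graph_nonnilpotent_graph)
  have "y \<rightarrow>\<^bsub>with_proj (nonnilpotent_graph S)\<^esub> x"
    using adj unfolding adjacent_iff by (auto simp: insert_commute)
  then have "x \<rightarrow>\<^sup>*\<^bsub>with_proj (nonnilpotent_graph S)\<^esub> y"
    "y \<rightarrow>\<^sup>*\<^bsub>with_proj (nonnilpotent_graph S)\<^esub> x"
    using adj by auto
  then show ?thesis
    using assms(2,3) unfolding nonnilpotent_components_def in_sccs_verts_conv_reachable by blast
qed

section \<open>Sorting indices by a total relation\<close>

text \<open>The permutation inverts the rank function of \<open>R\<close>.\<close>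

lemma ex_permutation_sorting:
  fixes R :: "nat \<Rightarrow> nat \<Rightarrow> bool"
  assumes total: "\<And>i j. \<lbrakk>i \<in> {1..n}; j \<in> {1..n}; i \<noteq> j\<rbrakk> \<Longrightarrow> R i j \<longleftrightarrow> \<not> R j i"
    and trans: "\<And>i j k. \<lbrakk>i \<in> {1..n}; j \<in> {1..n}; k \<in> {1..n}; i \<noteq> j; j \<noteq> k; R i j; R j k\<rbrakk> \<Longrightarrow> R i k"
  obtains \<sigma> where "\<sigma> permutes {1..n}"
    "\<And>i j. \<lbrakk>i \<in> {1..n}; j \<in> {1..n}; i < j\<rbrakk> \<Longrightarrow> R (\<sigma> i) (\<sigma> j)"
proof -
  let ?P = "\<lambda>i. {k \<in> {1..n}. k \<noteq> i \<and> R k i}"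
  \<comment> \<open>\<open>Suc\<close> makes the ranks start at 1, and the identity outside
    \<open>{1..n}\<close> is what \<open>permutes\<close> demands.\<close>
  define rank where "rank i = (if i \<in> {1..n} then Suc (card (?P i)) else i)" for i
  have mono: "rank i < rank j" if "i \<in> {1..n}" "j \<in> {1..n}" "i \<noteq> j" "R i j" for i j
  proof -
    \<comment> \<open>Transitivity gives the inclusion; it is proper because \<open>i\<close> lies
      in \<open>?P j\<close> but not in \<open>?P i\<close>.\<close>
    have "?P i \<subset> ?P j"
    proof
      show "?P i \<subseteq> ?P j"
        using that total trans by blast
      show "?P i \<noteq> ?P j" using that by blast
    qed
    then have "card (?P i) < card (?P j)" by (intro psubset_card_mono) auto
    then show ?thesis using that by (simp add: rank_def)
  qed
  have "inj_on rank {1..n}"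
    by (intro inj_onI) (metis less_irrefl mono total)
  moreover have "rank ` {1..n} \<subseteq> {1..n}"
  proof
    fix r assume "r \<in> rank ` {1..n}"
    then obtain i where i: "i \<in> {1..n}" "r = rank i" by blast
    have "?P i \<subset> {1..n}"
      by (rule psubsetI) (use i in blast)+
    then have "card (?P i) < card {1..n}" by (intro psubset_card_mono) auto
    then show "r \<in> {1..n}" using i by (simp add: rank_def)
  qed
  ultimately have "bij_betw rank {1..n} {1..n}"
    by (simp add: bij_betw_def endo_inj_surj)
  then have perm: "rank permutes {1..n}"
    by (intro bij_imp_permutes) (auto simp: rank_def)
  have "R (inv rank i) (inv rank j)" if ij: "i \<in> {1..n}" "j \<in> {1..n}" "i < j" for i j
  proof (rule ccontr)
    have eq: "rank (inv rank k) = k" for k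
      using perm by (rule permutes_inverses)
    assume not_R: "\<not> R (inv rank i) (inv rank j)"
    have mem: "inv rank k \<in> {1..n}" if "k \<in> {1..n}" for k
      using that perm by (meson permutes_in_image permutes_inv)
    have ne: "inv rank i \<noteq> inv rank j"
      using eq ij by (metis less_irrefl)
    \<comment> \<open>Totality reverses the failed relation, and monotonicity of \<open>rank\<close>
      then yields \<open>j < i\<close>.\<close>
    have "rank (inv rank j) < rank (inv rank i)"
      using mono[OF mem[OF ij(2)] mem[OF ij(1)]] total[OF mem[OF ij(1)] mem[OF ij(2)] ne]
        ne not_R by metis
    then show False using eq ij by simp
  qed
  with permutes_inv[OF perm] show thesis by (rule that)
qed

section \<open>The order on the classes of a band\<close>

text \<open>What is retained of the components once adjacency has become non-commutation;
  \<open>other\<close> records that no class is a singleton.\<close>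

locale commuting_partition =
  fixes S :: "'a::semigroup_mult set" and n :: nat and C :: "nat \<Rightarrow> 'a set"
  assumes closed: "\<lbrakk>x \<in> S; y \<in> S\<rbrakk> \<Longrightarrow> x * y \<in> S"
    and idem: "x \<in> S \<Longrightarrow> x * x = x"
    and Union_C: "(\<Union>i\<in>{1..n}. C i) = S"
    and disj: "disjoint_family_on C {1..n}"
    and other: "\<lbrakk>i \<in> {1..n}; x \<in> C i\<rbrakk> \<Longrightarrow> \<exists>y\<in>C i. y \<noteq> x"
    and nonempty: "i \<in> {1..n} \<Longrightarrow> C i \<noteq> {}"
    and commute_iff: "\<lbrakk>i \<in> {1..n}; j \<in> {1..n}; x \<in> C i; y \<in> C j\<rbrakk> \<Longrightarrow>
      x * y = y * x \<longleftrightarrow> x = y \<or> i \<noteq> j"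
begin

lemma mult_in_one_class:
  assumes "i \<in> {1..n}" "j \<in> {1..n}" "x \<in> C i" "y \<in> C j"
  shows "x * y \<in> C i \<or> x * y \<in> C j"
proof -
  have "x \<in> S" "y \<in> S" using assms Union_C by auto
  then have "x * y \<in> (\<Union>k\<in>{1..n}. C k)"
    unfolding Union_C by (rule closed)
  then obtain k where k: "k \<in> {1..n}" "x * y \<in> C k" by blast
  \<comment> \<open>\<open>z\<close> cannot commute with \<open>x * y\<close>, being a different
    member of its class; were that class a third one, \<open>z\<close> would commute with both
    factors.\<close>
  with other obtain z where z: "z \<in> C k" "z \<noteq> x * y" by blast
  show ?thesis
  proof (rule ccontr)
    assume "\<not> ?thesis"
    then have "k \<noteq> i" "k \<noteq> j" using k by auto
    then have "x * z = z * x" "y * z = z * y"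
      using commute_iff assms k z by metis+
    then have "x * y * z = z * (x * y)" by (metis mult.assoc)
    then show False
      using commute_iff[OF k(1,1,2) z(1)] z(2) by blast
  qed
qed

lemma subsemigroup_class: "i \<in> {1..n} \<Longrightarrow> subsemigroup (C i)"
  using mult_in_one_class nonempty unfolding subsemigroup_def by blast

text \<open>The natural order of the band lifted to classes: each \<open>u\<close> lies below each
  \<open>t\<close>, so the lower class \<open>C j\<close> is the one that will be the ideal.\<close>

definition above :: "nat \<Rightarrow> nat \<Rightarrow> bool" where
  "above i j \<longleftrightarrow> (\<forall>t\<in>C i. \<forall>u\<in>C j. u * t = u \<and> t * u = u)"

lemma comparable:
  assumes "i \<in> {1..n}" "j \<in> {1..n}" "i \<noteq> j" "x \<in> C i" "y \<in> C j"
  shows "x * y = y * x" "x * y = x \<or> x * y = y"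
proof -
  show comm: "x * y = y * x" using commute_iff assms by blast
  have S: "x \<in> S" "y \<in> S" using assms Union_C by auto
  \<comment> \<open>The product commutes with both factors, so it equals the factor whose class it
    lies in.\<close>
  have "x * (x * y) = x * y * x" "y * (x * y) = x * y * y"
    using comm by (metis mult.assoc)+
  then show "x * y = x \<or> x * y = y"
    using mult_in_one_class[OF assms(1,2,4,5)] commute_iff assms by metis
qed

text \<open>One pair decides for the whole classes. An exception would squeeze an element of one
  class between two members of the other in the natural order; those two would then commute and so
  coincide.\<close>

lemma above_if_witness:
  assumes ij: "i \<in> {1..n}" "j \<in> {1..n}" "i \<noteq> j"
    and tu: "t \<in> C i" "u \<in> C j" "t * u = u"
  shows "above i j"
proof -
  \<comment> \<open>Otherwise \<open>t'\<close> is below \<open>u\<close>, which is below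
    \<open>t\<close>, so \<open>t'\<close> and \<open>t\<close> commute.\<close>
  have upper: "t' * u = u" if t': "t' \<in> C i" for t'
  proof (rule ccontr)
    assume contr: "t' * u \<noteq> u"
    then have "t' * u = t'" using comparable[OF ij t' tu(2)] by blast
    moreover have "u * t' = t' * u" "u * t = t * u"
      using comparable(1)[OF ij] t' tu(1,2) by metis+
    ultimately have "t' * t = t'" "t * t' = t'"
      using tu(3) by (metis mult.assoc)+
    then have "t' = t" using commute_iff[OF ij(1,1) t' tu(1)] by auto
    with contr tu(3) show False by blast
  qed
  \<comment> \<open>Dually, \<open>u\<close> is below \<open>t'\<close> by \<open>upper\<close>, and
    an exception puts \<open>t'\<close> below \<open>u'\<close>.\<close>
  have "t' * u' = u'" if t': "t' \<in> C i" and u': "u' \<in> C j" for t' u'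
  proof (rule ccontr)
    assume contr: "t' * u' \<noteq> u'"
    then have "t' * u' = t'" using comparable[OF ij t' u'] by blast
    moreover have "u' * t' = t' * u'" "u * t' = t' * u"
      using comparable(1)[OF ij t'] u' tu(2) by metis+
    ultimately have "u * u' = u" "u' * u = u"
      using upper[OF t'] by (metis mult.assoc)+
    then have "u = u'" using commute_iff[OF ij(2,2) tu(2) u'] by auto
    with contr upper[OF t'] show False by blast
  qed
  then show ?thesis
    unfolding above_def using comparable(1)[OF ij] by metis
qed

text \<open>Comparability of a single pair \<open>t\<close>, \<open>u\<close> yields one of the two
  directions; both together would force \<open>t = u\<close>, against disjointness.\<close>

lemma above_asym:
  assumes ij: "i \<in> {1..n}" "j \<in> {1..n}" "i \<noteq> j"
  shows "above i j \<longleftrightarrow> \<not> above j i"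
proof -
  obtain t u where tu: "t \<in> C i" "u \<in> C j" using nonempty ij by blast
  then have "t \<noteq> u" using disjoint_family_onD[OF disj ij] by blast
  moreover have "above i j \<or> above j i"
    using comparable[OF ij tu] above_if_witness[OF ij tu]
      above_if_witness[OF ij(2,1) ij(3)[symmetric] tu(2,1)] by auto
  ultimately show ?thesis using tu unfolding above_def by metis
qed

lemma above_trans:
  assumes "i \<in> {1..n}" "j \<in> {1..n}" "k \<in> {1..n}" "i \<noteq> j" "j \<noteq> k" "above i j" "above j k"
  shows "above i k"
proof -
  obtain s where s: "s \<in> C i" using nonempty[OF assms(1)] by blast
  obtain t where t: "t \<in> C j" using nonempty[OF assms(2)] by blast
  obtain u where u: "u \<in> C k" using nonempty[OF assms(3)] by blast
  have "s * t = t" "t * u = u" using assms(6,7) s t u by (auto simp: above_def)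
  then have "s * u = u" by (metis mult.assoc)
  \<comment> \<open>With \<open>i = k\<close> the classes \<open>i\<close> and \<open>j\<close>
    would be above each other.\<close>
  moreover have "i \<noteq> k" using above_asym[OF assms(1,2,4)] assms(6,7) by blast
  ultimately show ?thesis using above_if_witness[OF assms(1,3) _ s u] by blast
qed

lemma is_angle_above:
  assumes "i \<in> {1..n}" "j \<in> {1..n}" "i \<noteq> j" "above i j"
  shows "is_angle (C i \<union> C j) (C i) (C j)"
proof -
  have "C i \<inter> C j = {}" using disjoint_family_onD[OF disj assms(1-3)] .
  moreover have "subsemigroup (C i)" "subsemigroup (C j)" using subsemigroup_class assms by auto
  moreover have "semigroup_ideal (C j) (C i \<union> C j)"
    using assms calculation(3) unfolding above_def semigroup_ideal_def subsemigroup_def by auto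
  ultimately show ?thesis
    using assms unfolding is_angle_def above_def by blast
qed

lemma ex_angle_seq: "\<exists>\<sigma>. \<sigma> permutes {1..n} \<and> is_angle_seq S n (\<lambda>i. C (\<sigma> i))"
proof -
  obtain \<sigma> where perm: "\<sigma> permutes {1..n}"
    and ord: "\<And>i j. \<lbrakk>i \<in> {1..n}; j \<in> {1..n}; i < j\<rbrakk> \<Longrightarrow> above (\<sigma> i) (\<sigma> j)"
    using ex_permutation_sorting[of n above] above_asym above_trans by blast
  have mem: "\<sigma> i \<in> {1..n}" if "i \<in> {1..n}" for i
    using perm that by (meson permutes_in_image)
  have inj: "\<sigma> i \<noteq> \<sigma> j" if "i \<noteq> j" for i j
    using permutes_inj[OF perm] that by (auto dest: injD)
  have "(\<Union>i\<in>{1..n}. C (\<sigma> i)) = (\<Union>i\<in>\<sigma> ` {1..n}. C i)"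
    by (simp only: image_image)
  then have "S = (\<Union>i\<in>{1..n}. C (\<sigma> i))"
    unfolding permutes_image[OF perm] Union_C by simp
  moreover have "disjoint_family_on (\<lambda>i. C (\<sigma> i)) {1..n}"
    using disj mem inj unfolding disjoint_family_on_def by blast
  moreover have "is_angle (C (\<sigma> i) \<union> C (\<sigma> j)) (C (\<sigma> i)) (C (\<sigma> j))"
    if "i \<in> {1..n}" "j \<in> {1..n}" "i < j" for i j
    using that ord mem inj by (intro is_angle_above) auto
  ultimately have "is_angle_seq S n (\<lambda>i. C (\<sigma> i))"
    unfolding is_angle_seq_def using subsemigroup_class mem by simp
  with perm show ?thesis by blast
qed

end

section \<open>From complete components to a commuting partition\<close>

theorem corollary3p8:
  fixes S :: "'a::semigroup_mult set"
    and n :: nat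
    and C :: "nat \<Rightarrow> 'a set"
  assumes "subsemigroup S"
    and "finite S"
    and "bij_betw C {1..n} (nonnilpotent_components S)"
    and "\<And>i. i \<in> {1..n} \<Longrightarrow> complete_component S (C i) \<and> card (C i) > 1"
  shows "\<exists>\<sigma>. \<sigma> permutes {1..n} \<and> is_angle_seq S n (\<lambda>i. C (\<sigma> i))"
proof -
  let ?adj = "\<lambda>x y. x \<in> S \<and> y \<in> S \<and> x \<noteq> y \<and> \<not> malcev_nilpotent (subsemigroup hull {x, y})"
  have closed: "x * y \<in> S" if "x \<in> S" "y \<in> S" for x y
    using assms(1) that by (simp add: subsemigroup_def)
  have comp: "C i \<in> nonnilpotent_components S" if "i \<in> {1..n}" for i
    using assms(3) that by (auto dest: bij_betwE)
  have Union_C: "(\<Union>i\<in>{1..n}. C i) = S"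
    using assms(3) Union_nonnilpotent_components[OF assms(2)] by (simp add: bij_betw_def)
  have disj: "disjoint_family_on C {1..n}"
    unfolding disjoint_family_on_def
    using assms(3) comp nonnilpotent_components_disjoint[OF assms(2)]
    by (metis bij_betw_imp_inj_on inj_onD)
  have other: "\<exists>y\<in>C i. y \<noteq> x" if "i \<in> {1..n}" for i x
  proof (rule ccontr)
    assume "\<not> ?thesis"
    then have "card (C i) \<le> card {x}" by (intro card_mono) auto
    with assms(4)[OF that] show False by simp
  qed
  have adj_step: "y \<in> C i" if "i \<in> {1..n}" "x \<in> C i" "?adj x y" for i x y
    using adjacent_same_component[OF assms(2) comp[OF that(1)] that(2)] that(3)
    unfolding adjacent_iff by blast
  have complete: "?adj x y" if "i \<in> {1..n}" "x \<in> C i" "y \<in> C i" "x \<noteq> y" for i x y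
    using assms(4)[OF that(1)] that unfolding complete_component_def adjacent_iff by blast
  have not_commute: "x * y \<noteq> y * x" if "?adj x y" for x y
    using that malcev_nilpotent_hull_commuting[of x y] by blast
  have idem: "x * x = x" if x: "x \<in> S" for x
  proof (rule ccontr)
    assume ne: "x * x \<noteq> x"
    have "x * x \<in> (\<Union>i\<in>{1..n}. C i)" unfolding Union_C using x x by (rule closed)
    then obtain i where i: "i \<in> {1..n}" "x * x \<in> C i" by blast
    with other obtain z where z: "z \<in> C i" "z \<noteq> x * x" by blast
    have adj: "?adj (x * x) z" using complete i z by metis
    \<comment> \<open>Non-nilpotency is inherited upwards, so this inclusion transfers adjacency
      with \<open>z\<close> from \<open>x * x\<close> to \<open>x\<close>.\<close>
    have sub: "subsemigroup hull {x * x, z} \<subseteq> subsemigroup hull {x, z}"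
    proof (rule hull_minimal)
      have "x \<in> subsemigroup hull {x, z}" "z \<in> subsemigroup hull {x, z}"
        using hull_subset[of "{x, z}" subsemigroup] by auto
      then show "{x * x, z} \<subseteq> subsemigroup hull {x, z}"
        using subsemigroup_hull[of "{x, z}"] by (auto simp: subsemigroup_def)
    qed (simp add: subsemigroup_hull)
    have "\<not> malcev_nilpotent (subsemigroup hull {z, x})"
      using adj malcev_nilpotent_subset[OF _ _ sub] by (auto simp: subsemigroup_hull insert_commute)
    \<comment> \<open>\<open>x\<close> commutes with \<open>x * x\<close>, whereas \<open>z\<close>
      does not.\<close>
    moreover have "z \<noteq> x" using not_commute[OF adj] by (auto simp: mult.assoc)
    ultimately have "x \<in> C i" using adj_step[OF i(1) z(1), of x] adj x by blast
    then have "?adj (x * x) x" using complete i ne by metis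
    from not_commute[OF this] show False by (simp add: mult.assoc)
  qed
  have adj_if: "?adj x y" if xy: "x \<in> S" "y \<in> S" "x * y \<noteq> y * x" for x y
  proof -
    \<comment> \<open>Inside \<open>S\<close> every element is idempotent, so the generated
      subsemigroup is a band containing a non-commuting pair.\<close>
    have "subsemigroup hull {x, y} \<subseteq> S"
      using xy assms(1) by (intro hull_minimal) auto
    moreover have "x \<in> subsemigroup hull {x, y}" "y \<in> subsemigroup hull {x, y}"
      using hull_subset[of "{x, y}" subsemigroup] by auto
    ultimately have "\<not> malcev_nilpotent (subsemigroup hull {x, y})"
      using idem xy by (intro not_malcev_nilpotent_band[of _ x y] subsemigroup_hull) auto
    with xy show ?thesis by auto
  qed
  have "x * y = y * x \<longleftrightarrow> x = y \<or> i \<noteq> j"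
    if ij: "i \<in> {1..n}" "j \<in> {1..n}" and xy: "x \<in> C i" "y \<in> C j" for i j x y
  proof
    assume "x * y = y * x"
    then show "x = y \<or> i \<noteq> j" using not_commute complete ij xy by metis
  next
    assume R: "x = y \<or> i \<noteq> j"
    show "x * y = y * x"
    proof (rule ccontr)
      assume nc: "x * y \<noteq> y * x"
      have "x \<in> S" "y \<in> S" using ij xy Union_C by auto
      \<comment> \<open>Non-commuting elements are adjacent and so share a component; disjointness
        then gives \<open>i = j\<close>, while \<open>x = y\<close> contradicts \<open>nc\<close>
        outright.\<close>
      then have "y \<in> C i" using adj_step[OF ij(1) xy(1)] adj_if nc by blast
      then have "i = j" using disj ij xy disjoint_family_onD[OF disj] by blast
      with R nc show False by auto
    qed
  qed
  moreover have "C i \<noteq> {}" if "i \<in> {1..n}" for i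
    using assms(4)[OF that] by auto
  ultimately interpret commuting_partition S n C
    using closed idem Union_C disj other by unfold_locales auto
  show ?thesis by (rule ex_angle_seq)
qed

end
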